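(* Let $H$ be a real Hilbert space and $T\colon H\to H$ a nonexpansive mapping with $\mathrm{Fix}(T)\neq\emptyset$. Suppose that $(x_n)_{n\in\mathbb{N}}$ is a sequence generated by the Line Search Fixed Point Algorithm (defined in the context) with $$\beta_n=\beta_n^{\mathrm{DY}}:=\frac{\|x_{n+1}-T(x_{n+1})\|^2}{\langle d_n,y_n\rangle}\quad(n\in\mathbb{N}),\qquad y_n:=(x_{n+1}-T(x_{n+1}))-(x_n-T(x_n)).$$ Then $(x_n)_{n\in\mathbb{N}}$ either terminates at a fixed point of $T$ or $$\lim_{n\to\infty}\|x_n-T(x_n)\|=0.$$
   Context: $\mathbb{N}=\{0,1,2,\dots\}$. $H$ has inner product $\langle\cdot,\cdot\rangle$ and induced norm $\|\cdot\|$. $T$ nonexpansive means $\|T(x)-T(y)\|\le\|x-y\|$ for all $x,y\in H$; $\mathrm{Fix}(T):=\{x\in H: T(x)=x\}$. Line Search Fixed Point Algorithm. Step 0: take $\delta,\sigma\in(0,1)$ with $\delta\le\sigma$; choose $x_0\in H$ arbitrarily, set $d_0:=-(x_0-T(x_0))$ and $n:=0$. Step 1: take $\alpha_n\in(0,1]$ satisfying the Wolfe-type conditions $$\|x_n(\alpha_n)-T(x_n(\alpha_n))\|^2-\|x_n-T(x_n)\|^2\le\delta\alpha_n\langle x_n-T(x_n),d_n\rangle,$$ $$\langle x_n(\alpha_n)-T(x_n(\alpha_n)),d_n\rangle\ge\sigma\langle x_n-T(x_n),d_n\rangle,$$ where $x_n(\alpha_n):=x_n+\alpha_n d_n$, and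 set $x_{n+1}:=x_n+\alpha_n d_n$. Step 2: if $\|x_{n+1}-T(x_{n+1})\|=0$, stop (the sequence is then said to terminate at the fixed point $x_{n+1}$). Step 3: compute $\beta_n\in\mathbb{R}$ by the chosen formula and set $d_{n+1}:=-(x_{n+1}-T(x_{n+1}))+\beta_n d_n$. Step 4: replace $n$ by $n+1$ and go to Step 1. It is assumed that step sizes $\alpha_n$ as required in Step 1 have been found at each iteration performed. *)

theory Defs
  imports "HOL-Analysis.Analysis"
begin

definition nonexpansive :: "('a::real_normed_vector \<Rightarrow> 'a) \<Rightarrow> bool" where
  "nonexpansive T \<longleftrightarrow> (\<forall>x y. norm (T x - T y) \<le> norm (x - y))"

definition Fix :: "('a \<Rightarrow> 'a) \<Rightarrow> 'a set" where
  "Fix T = {x. T x = x}"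

definition residual :: "('a::real_vector \<Rightarrow> 'a) \<Rightarrow> 'a \<Rightarrow> 'a" where
  "residual T x = x - T x"

definition wolfe_conditions ::
  "('a::real_inner \<Rightarrow> 'a) \<Rightarrow> real \<Rightarrow> real \<Rightarrow> 'a \<Rightarrow> 'a \<Rightarrow> real \<Rightarrow> bool" where
  "wolfe_conditions T \<delta> \<sigma> x d \<alpha> \<longleftrightarrow>
     (norm (residual T (x + \<alpha> *\<^sub>R d)))\<^sup>2 - (norm (residual T x))\<^sup>2
       \<le> \<delta> * \<alpha> * (residual T x \<bullet> d) \<and>
     residual T (x + \<alpha> *\<^sub>R d) \<bullet> d \<ge> \<sigma> * (residual T x \<bullet> d)"

text \<open>
  A run that stops is a finite sequence, but \<open>x\<close>, \<open>d\<close>, \<open>\<alpha>\<close>, \<open>\<beta>\<close> are total functions on the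
  naturals. Iteration \<open>n\<close> is the one that computes the point with index \<open>Suc n\<close>; it is
  performed iff the stopping test, which is applied to the points with index at least 1 only,
  has not succeeded before. Values after a stop are unconstrained.
\<close>

definition iteration_performed ::
  "('a::real_normed_vector \<Rightarrow> 'a) \<Rightarrow> (nat \<Rightarrow> 'a) \<Rightarrow> nat \<Rightarrow> bool" where
  "iteration_performed T x n \<longleftrightarrow> (\<forall>k<n. norm (residual T (x (Suc k))) \<noteq> 0)"

definition line_search_fixed_point_algorithm ::
  "('a::real_inner \<Rightarrow> 'a) \<Rightarrow> real \<Rightarrow> real \<Rightarrow> (nat \<Rightarrow> real) \<Rightarrow> (nat \<Rightarrow> real) \<Rightarrow>
   (nat \<Rightarrow> 'a) \<Rightarrow> (nat \<Rightarrow> 'a) \<Rightarrow> bool" where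
  "line_search_fixed_point_algorithm T \<delta> \<sigma> \<beta> \<alpha> d x \<longleftrightarrow>
     d 0 = - residual T (x 0) \<and>
     (\<forall>n. iteration_performed T x n \<longrightarrow>
        0 < \<alpha> n \<and> \<alpha> n \<le> 1 \<and>
        wolfe_conditions T \<delta> \<sigma> (x n) (d n) (\<alpha> n) \<and>
        x (Suc n) = x n + \<alpha> n *\<^sub>R d n \<and>
        (norm (residual T (x (Suc n))) \<noteq> 0 \<longrightarrow>
           d (Suc n) = - residual T (x (Suc n)) + \<beta> n *\<^sub>R d n))"

definition terminates_at ::
  "('a::real_normed_vector \<Rightarrow> 'a) \<Rightarrow> (nat \<Rightarrow> 'a) \<Rightarrow> 'a \<Rightarrow> bool" where
  "terminates_at T x p \<longleftrightarrow>
     (\<exists>n. iteration_performed T x n \<and> norm (residual T (x (Suc n))) = 0 \<and> p = x (Suc n))"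

text \<open>
  The denominator is automatically positive whenever the algorithm reaches the computation of
  \<open>\<beta>\<close> with this formula, so the convention for division by zero plays no role.
\<close>

definition beta_DY ::
  "('a::real_inner \<Rightarrow> 'a) \<Rightarrow> (nat \<Rightarrow> 'a) \<Rightarrow> (nat \<Rightarrow> 'a) \<Rightarrow> nat \<Rightarrow> real" where
  "beta_DY T d x n =
     (let y = residual T (x (Suc n)) - residual T (x n)
      in (norm (residual T (x (Suc n))))\<^sup>2 / (d n \<bullet> y))"

end

theory Submission
  imports Defs
begin

text \<open>
  Write \<open>g n\<close> for the residual at \<open>x n\<close> and \<open>D n\<close> for \<open>g n \<bullet> d n\<close>. The curvature condition makes
  \<open>d n \<bullet> y n\<close> positive as long as \<open>D n < 0\<close>, and the Dai-Yuan formula is exactly what gives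
  \<open>\<beta> n = D (n+1) / D n\<close>; hence all \<open>D n\<close> are negative. The residual is 2-Lipschitz, so the
  curvature condition bounds \<open>\<alpha> n\<close> from below, and sufficient decrease becomes Zoutendijk's
  inequality: with \<open>q n = \<parallel>d n\<parallel>\<^sup>2 / (D n)\<^sup>2\<close>, the quantity \<open>\<parallel>g n\<parallel>\<^sup>2\<close> drops by at least a constant
  times \<open>1 / q n\<close> in each step. Squaring \<open>d (n+1) + g (n+1) = \<beta> n d n\<close> gives
  \<open>q (n+1) \<le> q n + 1 / \<parallel>g (n+1)\<parallel>\<^sup>2\<close>. If \<open>\<parallel>g n\<parallel>\<close> stayed away from 0, then \<open>q\<close> would grow at
  most linearly and the drops would dominate a harmonic series.
\<close>

lemma residual_lipschitz:
  assumes "nonexpansive T"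
  shows "norm (residual T x - residual T y) \<le> 2 * norm (x - y)"
proof -
  have "norm (residual T x - residual T y) = norm ((x - y) - (T x - T y))"
    by (simp add: residual_def algebra_simps)
  also have "\<dots> \<le> norm (x - y) + norm (T x - T y)"
    by (rule norm_triangle_ineq4)
  also have "\<dots> \<le> 2 * norm (x - y)"
    using assms by (simp add: nonexpansive_def)
  finally show ?thesis .
qed

text \<open>Isolates the real-sequence argument: \<open>G\<close> stands for the squared residual
  norms, \<open>q\<close> for the ratios
  \<open>(norm (d n))\<^sup>2 / (D n)\<^sup>2\<close>.\<close>

lemma tendsto_zero_if_harmonic_decrease:
  fixes G q :: "nat \<Rightarrow> real"
  assumes "0 < c" and G_pos: "\<And>n. 0 < G n" and q_pos: "\<And>n. 0 < q n"
    and decrease: "\<And>n. c / q n \<le> G n - G (Suc n)"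
    and q_0: "q 0 \<le> 1 / G 0"
    and q_Suc: "\<And>n. q (Suc n) \<le> q n + 1 / G (Suc n)"
  shows "G \<longlonglongrightarrow> 0"
proof -
  have "decseq G"
  proof (rule decseq_SucI)
    fix n
    have "0 < c / q n" using \<open>0 < c\<close> q_pos by simp
    with decrease[of n] show "G (Suc n) \<le> G n" by linarith
  qed
  then obtain L where lim: "G \<longlonglongrightarrow> L" and L_le: "\<And>n. L \<le> G n"
    using decseq_convergent[of G 0] G_pos less_imp_le by metis
  have "0 \<le> L"
    using lim G_pos by (meson LIMSEQ_le_const less_imp_le)
  moreover have False if "0 < L"
  proof -
    have inverse_le: "1 / G n \<le> 1 / L" for n
      using that L_le by (simp add: frac_le)
    \<comment> \<open>The count is \<open>Suc n\<close> because \<open>q 0\<close> already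
      contributes one term 1 / \<open>L\<close>, and each step adds at most one more.\<close>
    have q_le: "q n \<le> real (Suc n) / L" for n
    proof (induction n)
      case 0
      show ?case using q_0 inverse_le[of 0] by simp
    next
      case (Suc n)
      then show ?case
        using q_Suc[of n] inverse_le[of "Suc n"] by (simp add: add_divide_distrib)
    qed
    \<comment> \<open>The drops telescope to \<open>G 0 - L\<close>, yet each is at least
      \<open>c * L\<close> / (n + 1).\<close>
    have "summable (\<lambda>n. G n - G (Suc n))"
      by (rule telescope_summable'[OF lim])
    moreover have "norm (c * L * inverse (real (Suc n))) \<le> G n - G (Suc n)" for n
    proof -
      have "c * L * inverse (real (Suc n)) = c / (real (Suc n) / L)"
        by (simp add: field_simps)
      also have "\<dots> \<le> c / q n"
        using \<open>0 < c\<close> q_pos q_le by (intro divide_left_mono) (auto simp: that)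
      also have "\<dots> \<le> G n - G (Suc n)" by (rule decrease)
      finally show ?thesis using \<open>0 < c\<close> that by simp
    qed
    ultimately have "summable (\<lambda>n. c * L * inverse (real (Suc n)))"
      by (rule summable_comparison_test')
    then have "summable (\<lambda>n. inverse (real (Suc n)))"
      using \<open>0 < c\<close> that by (simp add: summable_cmult_iff del: of_nat_Suc)
    then have "summable (\<lambda>n. inverse (real n))"
      by (subst (asm) summable_Suc_iff)
    then show False using not_summable_harmonic[where 'a=real] by simp
  qed
  ultimately have "L = 0" by fastforce
  with lim show ?thesis by simp
qed

text \<open>With \<beta> the Dai-Yuan quotient, its denominator turns \<open>g' \<bullet> d'\<close>
  into \<beta> times \<open>g \<bullet> d\<close>. Curvature and \<sigma> < 1 make that denominator
  positive, so the sign of \<open>g \<bullet> d\<close> is inherited.\<close>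

lemma dai_yuan_descent:
  fixes g g' d d' :: "'a::real_inner"
  assumes "g \<bullet> d < 0" "\<sigma> < 1" "\<sigma> * (g \<bullet> d) \<le> g' \<bullet> d"
    and d': "d' = - g' + ((norm g')\<^sup>2 / (d \<bullet> (g' - g))) *\<^sub>R d"
  shows "(norm g')\<^sup>2 / (d \<bullet> (g' - g)) = (g' \<bullet> d') / (g \<bullet> d)"
    and "g' \<noteq> 0 \<Longrightarrow> g' \<bullet> d' < 0"
proof -
  have "g \<bullet> d < \<sigma> * (g \<bullet> d)" using assms by simp
  also have "\<dots> \<le> g' \<bullet> d" by fact
  finally have pos: "0 < d \<bullet> (g' - g)"
    by (simp add: inner_diff_right inner_commute)
  have "g' \<bullet> d' = - (norm g')\<^sup>2 + (norm g')\<^sup>2 / (d \<bullet> (g' - g)) * (g' \<bullet> d)"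
    by (subst d') (simp only: inner_add_right inner_minus_right inner_scaleR_right dot_square_norm)
  \<comment> \<open>\<open>(norm g')\<^sup>2\<close> is rewritten as the quotient times its own
    denominator, so that the quotient factors out.\<close>
  also have "\<dots> = (norm g')\<^sup>2 / (d \<bullet> (g' - g)) * (g' \<bullet> d - d \<bullet> (g' - g))"
    using pos by (simp add: right_diff_distrib)
  also have "g' \<bullet> d - d \<bullet> (g' - g) = g \<bullet> d"
    by (simp add: inner_diff_right inner_commute)
  finally have eq: "g' \<bullet> d' = (norm g')\<^sup>2 / (d \<bullet> (g' - g)) * (g \<bullet> d)" .
  then show "(norm g')\<^sup>2 / (d \<bullet> (g' - g)) = (g' \<bullet> d') / (g \<bullet> d)"
    using \<open>g \<bullet> d < 0\<close> by simp
  show "g' \<bullet> d' < 0" if "g' \<noteq> 0"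
    unfolding eq using that pos \<open>g \<bullet> d < 0\<close> by (intro mult_pos_neg) auto
qed

lemma direction_ratio_step:
  fixes g' d d' :: "'a::real_inner"
  assumes d': "d' = - g' + ((g' \<bullet> d') / D) *\<^sub>R d"
    and "g' \<bullet> d' \<noteq> 0" "g' \<noteq> 0"
  shows "(norm d')\<^sup>2 / (g' \<bullet> d')\<^sup>2 \<le> (norm d)\<^sup>2 / D\<^sup>2 + 1 / (norm g')\<^sup>2"
proof -
  define D' where "D' = g' \<bullet> d'"
  define G where "G = (norm g')\<^sup>2"
  have "D' \<noteq> 0" "0 < G" using assms by (auto simp: D'_def G_def)
  have "d' + g' = (D' / D) *\<^sub>R d" using d' by (simp add: D'_def algebra_simps)
  then have "(norm (d' + g'))\<^sup>2 = (D' / D)\<^sup>2 * (norm d)\<^sup>2"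
    by (simp add: power_mult_distrib power_divide)
  moreover have "(norm (d' + g'))\<^sup>2 = (norm d')\<^sup>2 + 2 * D' + G"
    by (simp add: D'_def G_def power2_norm_eq_inner inner_add_left inner_add_right inner_commute)
  ultimately have "(norm d')\<^sup>2 = D'\<^sup>2 * ((norm d)\<^sup>2 / D\<^sup>2) - 2 * D' - G"
    by (simp add: power_divide)
  then have "(norm d')\<^sup>2 / D'\<^sup>2 = (norm d)\<^sup>2 / D\<^sup>2 - (2 * D' + G) / D'\<^sup>2"
    using \<open>D' \<noteq> 0\<close> by (simp add: diff_divide_distrib add_divide_distrib)
  \<comment> \<open>Completing the square: the two sides differ by
    \<open>(D' + G)\<^sup>2 / (G * D'\<^sup>2)\<close>.\<close>
  moreover have "- ((2 * D' + G) / D'\<^sup>2) \<le> 1 / G"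
  proof -
    have "0 \<le> (D' + G)\<^sup>2" by simp
    then have "- (2 * D' + G) * G \<le> D'\<^sup>2"
      by (simp add: power2_eq_square algebra_simps)
    then show ?thesis using \<open>0 < G\<close> \<open>D' \<noteq> 0\<close> by (simp add: field_simps)
  qed
  ultimately show ?thesis unfolding D'_def G_def by linarith
qed

text \<open>Curvature and Cauchy-Schwarz enclose \<open>y \<bullet> d\<close> between
  \<open>(1 - \<sigma>) * - D\<close> and \<open>2 * \<alpha> * (norm d)\<^sup>2\<close>, where 2 is
  the Lipschitz constant of the residual. The resulting lower bound on \<alpha> goes into the
  decrease condition.\<close>

lemma wolfe_zoutendijk:
  fixes T :: "'a::real_inner \<Rightarrow> 'a"
  assumes "nonexpansive T" "0 < \<delta>" "\<sigma> < 1" "0 < \<alpha>"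
    and wolfe: "wolfe_conditions T \<delta> \<sigma> x d \<alpha>"
    and descent: "residual T x \<bullet> d < 0"
  shows "\<delta> * (1 - \<sigma>) / 2 / ((norm d)\<^sup>2 / (residual T x \<bullet> d)\<^sup>2)
    \<le> (norm (residual T x))\<^sup>2 - (norm (residual T (x + \<alpha> *\<^sub>R d)))\<^sup>2"
proof -
  define D where "D = residual T x \<bullet> d"
  define y where "y = residual T (x + \<alpha> *\<^sub>R d) - residual T x"
  have "D < 0" using descent by (simp add: D_def)
  then have "d \<noteq> 0" by (auto simp: D_def)
  have "norm y \<le> 2 * (\<alpha> * norm d)"
    using residual_lipschitz[OF \<open>nonexpansive T\<close>, of "x + \<alpha> *\<^sub>R d" x] \<open>0 < \<alpha>\<close>
    by (simp add: y_def)
  then have "norm y * norm d \<le> 2 * (\<alpha> * norm d) * norm d"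
    by (rule mult_right_mono) simp
  then have "y \<bullet> d \<le> 2 * \<alpha> * (norm d)\<^sup>2"
    using norm_cauchy_schwarz[of y d] by (simp add: power2_eq_square mult.assoc)
  moreover have "(1 - \<sigma>) * - D \<le> y \<bullet> d"
    using wolfe by (simp add: wolfe_conditions_def D_def y_def inner_diff_left algebra_simps)
  ultimately have "(1 - \<sigma>) * - D / (2 * (norm d)\<^sup>2) \<le> \<alpha>"
    using \<open>d \<noteq> 0\<close> by (simp add: field_simps)
  then have "\<delta> * - D * ((1 - \<sigma>) * - D / (2 * (norm d)\<^sup>2)) \<le> \<delta> * - D * \<alpha>"
    using \<open>0 < \<delta>\<close> \<open>D < 0\<close> by (intro mult_left_mono) (auto simp: mult_nonneg_nonpos)
  moreover have "\<delta> * - D * ((1 - \<sigma>) * - D / (2 * (norm d)\<^sup>2))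
      = \<delta> * (1 - \<sigma>) / 2 / ((norm d)\<^sup>2 / D\<^sup>2)"
    by (simp add: power2_eq_square)
  moreover have "\<delta> * - D * \<alpha>
      \<le> (norm (residual T x))\<^sup>2 - (norm (residual T (x + \<alpha> *\<^sub>R d)))\<^sup>2"
    using wolfe by (simp add: wolfe_conditions_def D_def mult_ac)
  ultimately show ?thesis unfolding D_def by linarith
qed

theorem theorem2p2:
  fixes T :: "'a::{real_inner, complete_space} \<Rightarrow> 'a"
    and \<delta> \<sigma> :: real
    and \<alpha> :: "nat \<Rightarrow> real"
    and d x :: "nat \<Rightarrow> 'a"
  assumes "nonexpansive T"
    and "Fix T \<noteq> {}"
    and "0 < \<delta>" "\<delta> < 1"
    and "0 < \<sigma>" "\<sigma> < 1"
    and "\<delta> \<le> \<sigma>"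
    and "line_search_fixed_point_algorithm T \<delta> \<sigma> (beta_DY T d x) \<alpha> d x"
  shows "(\<exists>p \<in> Fix T. terminates_at T x p) \<or>
         (\<lambda>n. norm (x n - T (x n))) \<longlonglongrightarrow> 0"
proof (cases "\<exists>p. terminates_at T x p")
  case True
  then obtain p where p: "terminates_at T x p" by blast
  then have "p \<in> Fix T" by (auto simp: terminates_at_def Fix_def residual_def)
  with p show ?thesis by blast
next
  case False
  define g where "g n = residual T (x n)" for n
  define D where "D n = g n \<bullet> d n" for n
  note alg = assms(8)[unfolded line_search_fixed_point_algorithm_def]
  \<comment> \<open>Strong induction, since iteration \<open>n\<close> is performed only if all
    earlier tests failed; a zero residual would then mean termination.\<close>
  have g_Suc_nz: "g (Suc n) \<noteq> 0" for n
  proof (induction n rule: less_induct)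
    case (less n)
    then have "iteration_performed T x n"
      by (simp add: iteration_performed_def g_def)
    with False show ?case by (auto simp: terminates_at_def g_def)
  qed
  then have performed: "iteration_performed T x n" for n
    by (simp add: iteration_performed_def g_def)
  have alpha: "0 < \<alpha> n" and wolfe: "wolfe_conditions T \<delta> \<sigma> (x n) (d n) (\<alpha> n)"
    and x_Suc: "x (Suc n) = x n + \<alpha> n *\<^sub>R d n"
    and d_Suc: "d (Suc n) = - g (Suc n) + beta_DY T d x n *\<^sub>R d n" for n
    using alg performed g_Suc_nz by (auto simp: g_def)
  have d_0: "d 0 = - g 0" using alg by (simp add: g_def)
  have g_nz: "g n \<noteq> 0" for n
  proof (cases n)
    case 0
    \<comment> \<open>The stopping test never examines \<open>x 0\<close>. A zero residual there
      gives \<open>d 0 = 0\<close>, so \<open>x 1\<close> would repeat \<open>x 0\<close> and have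
      zero residual too.\<close>
    have "g 0 \<noteq> 0"
    proof
      assume "g 0 = 0"
      then have "x 1 = x 0" using x_Suc[of 0] d_0 by simp
      with \<open>g 0 = 0\<close> g_Suc_nz[of 0] show False by (simp add: g_def)
    qed
    with 0 show ?thesis by simp
  qed (use g_Suc_nz in simp)
  have beta: "beta_DY T d x n = (norm (g (Suc n)))\<^sup>2 / (d n \<bullet> (g (Suc n) - g n))" for n
    by (simp add: beta_DY_def g_def)
  have curvature: "\<sigma> * (g n \<bullet> d n) \<le> g (Suc n) \<bullet> d n" for n
    using wolfe[of n] by (simp add: wolfe_conditions_def g_def x_Suc)
  have D_neg: "D n < 0" for n
  proof (induction n)
    case 0
    show ?case using g_nz[of 0] by (simp add: D_def d_0)
  next
    case (Suc n)
    then show ?case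
      using dai_yuan_descent(2)[OF _ \<open>\<sigma> < 1\<close> curvature d_Suc[unfolded beta]] g_nz
      by (simp add: D_def)
  qed
  have beta_eq: "beta_DY T d x n = D (Suc n) / D n" for n
    using dai_yuan_descent(1)[OF _ \<open>\<sigma> < 1\<close> curvature d_Suc[unfolded beta]] D_neg[of n]
    by (simp add: D_def beta)
  define q where "q n = (norm (d n))\<^sup>2 / (D n)\<^sup>2" for n
  have "(\<lambda>n. (norm (g n))\<^sup>2) \<longlonglongrightarrow> 0"
  proof (rule tendsto_zero_if_harmonic_decrease[where q = q and c = "\<delta> * (1 - \<sigma>) / 2"])
    show "0 < \<delta> * (1 - \<sigma>) / 2" using assms by simp
    show "0 < (norm (g n))\<^sup>2" for n using g_nz by simp
    show "0 < q n" for n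
    proof -
      have "d n \<noteq> 0" using D_neg[of n] by (auto simp: D_def)
      with D_neg[of n] show ?thesis by (simp add: q_def)
    qed
    show "\<delta> * (1 - \<sigma>) / 2 / q n \<le> (norm (g n))\<^sup>2 - (norm (g (Suc n)))\<^sup>2" for n
      using wolfe_zoutendijk[OF \<open>nonexpansive T\<close> \<open>0 < \<delta>\<close> \<open>\<sigma> < 1\<close> alpha wolfe] D_neg[of n]
      by (simp add: q_def D_def g_def x_Suc)
    \<comment> \<open>Equality holds here: \<open>d 0 = - g 0\<close> gives
      \<open>D 0 = - (norm (g 0))\<^sup>2\<close>.\<close>
    show "q 0 \<le> 1 / (norm (g 0))\<^sup>2"
      by (simp add: q_def D_def d_0 dot_square_norm power2_eq_square)
    show "q (Suc n) \<le> q n + 1 / (norm (g (Suc n)))\<^sup>2" for n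
      \<comment> \<open>\<open>D n\<close> stays folded: it instantiates the free parameter
        \<open>D\<close> of \<open>direction_ratio_step\<close>.\<close>
      unfolding q_def D_def[of "Suc n"]
    proof (rule direction_ratio_step)
      show "d (Suc n) = - g (Suc n) + (g (Suc n) \<bullet> d (Suc n) / D n) *\<^sub>R d n"
        using d_Suc[of n] unfolding beta_eq D_def[of "Suc n"] .
      show "g (Suc n) \<bullet> d (Suc n) \<noteq> 0"
        using D_neg[of "Suc n"] by (simp add: D_def)
    qed (rule g_nz)
  qed
  then have "(\<lambda>n. norm (g n)) \<longlonglongrightarrow> 0" by simp
  then show ?thesis by (simp add: g_def residual_def)
qed

end
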